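(* Let $H$ be a connected graph which is edge-transitive under its stable involution group $S_H$. If there exists a strong percolating sequence $J_0,J_1,\dots,J_N$ in $H$, then $H$ is norming.
   Context: For a connected graph $H$, a cut involution is an automorphism $\phi$ with $\phi=\phi^{-1}$ whose fixed point set $F_\phi$ is a vertex cut; it is a stable involution if moreover $F_\phi$ is an independent set of $H$. $S_H$ is the subgroup of $\mathrm{Aut}(H)$ generated by stable involutions. For each cut involution $\phi$, fix disjoint sets $L_\phi,R_\phi$ partitioning $V(H)\setminus F_\phi$, each a union of components of $H\setminus F_\phi$, with $\phi(L_\phi)=R_\phi$. Left-folding map: $\phi^+(v)=\phi(v)$ if $v\in R_\phi$, $\phi^+(v)=v$ otherwise; $\phi^-$ swaps the roles of $L_\phi,R_\phi$. For $J\subseteq E(H)$, $J^{\pm}(\phi)=\{uv\in E(H):\phi^{\pm}(u)\phi^{\pm}(v)\in J\}$. A percolating sequence is a finite sequence $J_0,\dots,J_N$ of edge sets with $|J_0|=1$, $J_N=E(H)$, and for each $i$, $J_{i+1}=J_i^+(\phi)$ or $J_i^-(\phi)$ for some cut involution $\phi$; it is strong if every cut involution used is a stable involution. With $\|f\|_H:=\left|\int\prod_{ij\in E(H)}f(x_i,x_j)\,d\mu^{|V(H)|}\right|^{1/|E(H)|}$ ($\mu$ Lebesgue measure), $H$ is norming if $\|\cdot\|_H$ is a semi-norm on bounded measurable functions $[0,1]^2\to\mathbb{R}$. *)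

theory Defs
  imports "HOL-Analysis.Analysis" "HOL-Algebra.Bij" "HOL-Algebra.Generated_Groups"
begin

section \<open>Graphs and their automorphisms\<close>

text \<open>A finite simple graph is a pair of a vertex set \<open>V\<close> and a set \<open>E\<close> of two-element subsets of \<open>V\<close>.\<close>

definition simple_graph :: "'v set \<Rightarrow> 'v set set \<Rightarrow> bool" where
  "simple_graph V E \<longleftrightarrow> finite V \<and> (\<forall>e\<in>E. e \<subseteq> V \<and> card e = 2)"

definition induced_adj :: "'v set set \<Rightarrow> 'v set \<Rightarrow> ('v \<times> 'v) set" where
  "induced_adj E U = {(u, v). u \<in> U \<and> v \<in> U \<and> {u, v} \<in> E}"

text \<open>Vertex sets of the connected components of the subgraph induced on \<open>U\<close>.\<close>

definition components_on :: "'v set set \<Rightarrow> 'v set \<Rightarrow> 'v set set" where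
  "components_on E U = U // ((induced_adj E U)\<^sup>* \<inter> U \<times> U)"

definition graph_connected :: "'v set \<Rightarrow> 'v set set \<Rightarrow> bool" where
  "graph_connected V E \<longleftrightarrow> V \<noteq> {} \<and> (\<forall>u\<in>V. \<forall>v\<in>V. (u, v) \<in> (induced_adj E V)\<^sup>*)"

definition vertex_cut :: "'v set \<Rightarrow> 'v set set \<Rightarrow> 'v set \<Rightarrow> bool" where
  "vertex_cut V E F \<longleftrightarrow> F \<subseteq> V \<and> 2 \<le> card (components_on E (V - F))"

definition independent_set :: "'v set \<Rightarrow> 'v set set \<Rightarrow> 'v set \<Rightarrow> bool" where
  "independent_set V E F \<longleftrightarrow> F \<subseteq> V \<and> (\<forall>u\<in>F. \<forall>v\<in>F. {u, v} \<notin> E)"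

definition graph_auto :: "'v set \<Rightarrow> 'v set set \<Rightarrow> ('v \<Rightarrow> 'v) set" where
  "graph_auto V E = {\<phi> \<in> Bij V. \<forall>u\<in>V. \<forall>v\<in>V. {\<phi> u, \<phi> v} \<in> E \<longleftrightarrow> {u, v} \<in> E}"

definition Aut_graph :: "'v set \<Rightarrow> 'v set set \<Rightarrow> ('v \<Rightarrow> 'v) monoid" where
  "Aut_graph V E = (BijGroup V)\<lparr>carrier := graph_auto V E\<rparr>"


section \<open>Cut involutions and stable involutions\<close>

definition fixed_points :: "'v set \<Rightarrow> ('v \<Rightarrow> 'v) \<Rightarrow> 'v set" where
  "fixed_points V \<phi> = {v \<in> V. \<phi> v = v}"

definition cut_involution :: "'v set \<Rightarrow> 'v set set \<Rightarrow> ('v \<Rightarrow> 'v) \<Rightarrow> bool" where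
  "cut_involution V E \<phi> \<longleftrightarrow> \<phi> \<in> graph_auto V E \<and> (\<forall>v\<in>V. \<phi> (\<phi> v) = v)
     \<and> vertex_cut V E (fixed_points V \<phi>)"

definition stable_involution :: "'v set \<Rightarrow> 'v set set \<Rightarrow> ('v \<Rightarrow> 'v) \<Rightarrow> bool" where
  "stable_involution V E \<phi> \<longleftrightarrow> cut_involution V E \<phi> \<and> independent_set V E (fixed_points V \<phi>)"

definition stable_involution_group :: "'v set \<Rightarrow> 'v set set \<Rightarrow> ('v \<Rightarrow> 'v) set" where
  "stable_involution_group V E = generate (Aut_graph V E) {\<phi>. stable_involution V E \<phi>}"

definition edge_transitive_under :: "('v \<Rightarrow> 'v) set \<Rightarrow> 'v set set \<Rightarrow> bool" where
  "edge_transitive_under S E \<longleftrightarrow> (\<forall>e\<in>E. \<forall>e'\<in>E. \<exists>\<sigma>\<in>S. \<sigma> ` e = e')"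


section \<open>Folding and percolation\<close>

definition cut_sides :: "'v set \<Rightarrow> 'v set set \<Rightarrow> ('v \<Rightarrow> 'v) \<Rightarrow> 'v set \<Rightarrow> 'v set \<Rightarrow> bool" where
  "cut_sides V E \<phi> A B \<longleftrightarrow> A \<inter> B = {} \<and> A \<union> B = V - fixed_points V \<phi>
     \<and> (\<exists>\<C> \<subseteq> components_on E (V - fixed_points V \<phi>). A = \<Union>\<C>)
     \<and> (\<exists>\<C> \<subseteq> components_on E (V - fixed_points V \<phi>). B = \<Union>\<C>)
     \<and> \<phi> ` A = B"

text \<open>
  \<open>L\<close> and \<open>R\<close> fix the two sides of every cut involution. A cut involution may map a component of
  the complement of its fixed point set to itself; it then has no sides, nothing is required of
  \<open>L\<close> and \<open>R\<close> there, and the involution cannot be used for folding.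
\<close>

definition sides_choice ::
    "'v set \<Rightarrow> 'v set set \<Rightarrow> (('v \<Rightarrow> 'v) \<Rightarrow> 'v set) \<Rightarrow> (('v \<Rightarrow> 'v) \<Rightarrow> 'v set) \<Rightarrow> bool" where
  "sides_choice V E L R \<longleftrightarrow>
     (\<forall>\<phi>. cut_involution V E \<phi> \<and> (\<exists>A B. cut_sides V E \<phi> A B) \<longrightarrow> cut_sides V E \<phi> (L \<phi>) (R \<phi>))"

text \<open>
  The left-folding map is \<open>fold_map (R \<phi>) \<phi>\<close>, the right-folding map is \<open>fold_map (L \<phi>) \<phi>\<close>.
\<close>

definition fold_map :: "'v set \<Rightarrow> ('v \<Rightarrow> 'v) \<Rightarrow> 'v \<Rightarrow> 'v" where
  "fold_map A \<phi> v = (if v \<in> A then \<phi> v else v)"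

definition pull_edges :: "'v set set \<Rightarrow> ('v \<Rightarrow> 'v) \<Rightarrow> 'v set set \<Rightarrow> 'v set set" where
  "pull_edges E g J = {e \<in> E. g ` e \<in> J}"

text \<open>\<open>\<Phi>\<close> is the set of cut involutions that may be used in the steps.\<close>

definition percolating_sequence_via ::
    "'v set \<Rightarrow> 'v set set \<Rightarrow> (('v \<Rightarrow> 'v) \<Rightarrow> 'v set) \<Rightarrow> (('v \<Rightarrow> 'v) \<Rightarrow> 'v set) \<Rightarrow>
     ('v \<Rightarrow> 'v) set \<Rightarrow> (nat \<Rightarrow> 'v set set) \<Rightarrow> nat \<Rightarrow> bool" where
  "percolating_sequence_via V E L R \<Phi> J N \<longleftrightarrow>
     (\<forall>i\<le>N. J i \<subseteq> E) \<and> card (J 0) = 1 \<and> J N = E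
     \<and> (\<forall>i<N. \<exists>\<phi>\<in>\<Phi>. cut_involution V E \<phi> \<and> cut_sides V E \<phi> (L \<phi>) (R \<phi>)
          \<and> (J (Suc i) = pull_edges E (fold_map (R \<phi>) \<phi>) (J i)
             \<or> J (Suc i) = pull_edges E (fold_map (L \<phi>) \<phi>) (J i)))"

definition strong_percolating_sequence ::
    "'v set \<Rightarrow> 'v set set \<Rightarrow> (('v \<Rightarrow> 'v) \<Rightarrow> 'v set) \<Rightarrow> (('v \<Rightarrow> 'v) \<Rightarrow> 'v set) \<Rightarrow>
     (nat \<Rightarrow> 'v set set) \<Rightarrow> nat \<Rightarrow> bool" where
  "strong_percolating_sequence V E L R J N \<longleftrightarrow>
     percolating_sequence_via V E L R {\<phi>. stable_involution V E \<phi>} J N"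


section \<open>Norming graphs\<close>

definition seminorm_on :: "('a \<Rightarrow> real) set \<Rightarrow> (('a \<Rightarrow> real) \<Rightarrow> real) \<Rightarrow> bool" where
  "seminorm_on X N \<longleftrightarrow> (\<forall>f\<in>X. 0 \<le> N f) \<and> (\<forall>c. \<forall>f\<in>X. N (\<lambda>p. c * f p) = \<bar>c\<bar> * N f)
     \<and> (\<forall>f\<in>X. \<forall>g\<in>X. N (\<lambda>p. f p + g p) \<le> N f + N g)"

text \<open>Bounded Lebesgue measurable functions on the unit square; values outside it are irrelevant.\<close>

definition kernels :: "(real \<times> real \<Rightarrow> real) set" where
  "kernels = {f. f \<in> borel_measurable (lebesgue_on ({0..1} \<times> {0..1}))
                 \<and> bounded (f ` ({0..1} \<times> {0..1}))}"

text \<open>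
  Lebesgue measure on the cube with coordinates indexed by \<open>V\<close>. The product measure has to be
  completed: for a kernel \<open>f\<close> that is Lebesgue but not Borel measurable, \<open>f (x a, x b)\<close> is in
  general not measurable with respect to the uncompleted product.
\<close>

definition cube_measure :: "'v set \<Rightarrow> ('v \<Rightarrow> real) measure" where
  "cube_measure V = completion (Pi\<^sub>M V (\<lambda>_. restrict_space lborel {0..1}))"

definition bipartition :: "'v set \<Rightarrow> 'v set set \<Rightarrow> 'v set \<Rightarrow> 'v set \<Rightarrow> bool" where
  "bipartition V E A B \<longleftrightarrow> A \<inter> B = {} \<and> A \<union> B = V \<and> (\<forall>e\<in>E. \<exists>a\<in>A. \<exists>b\<in>B. e = {a, b})"

text \<open>
  Kernels are not assumed symmetric, so every edge needs a direction in \<open>f (x\<^sub>i, x\<^sub>j)\<close>: edges are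
  read from \<open>A\<close> to \<open>B\<close>, for a bipartition \<open>(A, B)\<close>. On symmetric kernels the direction is immaterial.
\<close>

definition graph_norm ::
    "'v set \<Rightarrow> 'v set set \<Rightarrow> 'v set \<Rightarrow> 'v set \<Rightarrow> (real \<times> real \<Rightarrow> real) \<Rightarrow> real" where
  "graph_norm V E A B f =
     \<bar>\<integral>x. (\<Prod>(a, b) \<in> {(a, b). a \<in> A \<and> b \<in> B \<and> {a, b} \<in> E}. f (x a, x b)) \<partial>cube_measure V\<bar>
       powr (1 / real (card E))"

text \<open>
  Norming graphs are bipartite, already when only symmetric kernels are considered. Bipartiteness
  is made part of the definition because \<open>graph_norm\<close> needs a bipartition.
\<close>

definition norming :: "'v set \<Rightarrow> 'v set set \<Rightarrow> bool" where
  "norming V E \<longleftrightarrow> (\<exists>A B. bipartition V E A B)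
     \<and> (\<forall>A B. bipartition V E A B \<longrightarrow> seminorm_on kernels (graph_norm V E A B))"

end

theory Submission
  imports Defs "HOL-Probability.Infinite_Product_Measure"
begin

text \<open>
  Let \<open>I(\<alpha>)\<close> be the integral in which every edge \<open>e\<close> carries its own kernel \<open>\<alpha> e\<close>. The fixed
  point set of a stable involution carries no edges and separates its two sides, so Cauchy-Schwarz
  over the fixed coordinates gives \<open>I(\<alpha>)\<^sup>2 \<le> I(\<alpha> \<circ> \<phi>\<^sup>+) I(\<alpha> \<circ> \<phi>\<^sup>-)\<close>. Scale two kernels \<open>f\<close>, \<open>g\<close> by numbers
  slightly above their norms and colour the edges by \<open>f\<close> and \<open>g\<close> so that \<open>\<bar>I\<bar>\<close> is maximal. Folding
  preserves maximality, so along the percolating sequence one reaches a constant colouring, whose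
  integral is at most 1 in absolute value. Hence every colouring satisfies the corresponding Hoelder
  inequality, and expanding the product for \<open>f + g\<close> gives the triangle inequality. The composite of
  the folding maps sends every edge to the single edge of \<open>J\<^sub>0\<close>, which yields the bipartition.
\<close>

section \<open>Cauchy-Schwarz across a cut\<close>

text \<open>The integral of \<open>(s * g x - t * k x)\<^sup>2\<close> is a non-negative quadratic
  form in \<open>s\<close> and \<open>t\<close>, which bounds its discriminant. Boundedness on a
  finite measure space makes all three products integrable.\<close>

lemma (in finite_measure) Cauchy_Schwarz_bounded:
  fixes g k :: "'a \<Rightarrow> real"
  assumes [measurable]: "g \<in> borel_measurable M" "k \<in> borel_measurable M"
    and g: "\<And>x. x \<in> space M \<Longrightarrow> \<bar>g x\<bar> \<le> C" and k: "\<And>x. x \<in> space M \<Longrightarrow> \<bar>k x\<bar> \<le> C"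
  shows "(\<integral>x. g x * k x \<partial>M)\<^sup>2 \<le> (\<integral>x. g x * g x \<partial>M) * (\<integral>x. k x * k x \<partial>M)"
proof -
  define a b c where "a = (\<integral>x. g x * g x \<partial>M)" and "b = (\<integral>x. g x * k x \<partial>M)"
    and "c = (\<integral>x. k x * k x \<partial>M)"
  have bd: "\<bar>u * v\<bar> \<le> C * C" if "\<bar>u\<bar> \<le> C" "\<bar>v\<bar> \<le> C" for u v :: real
    using that by (auto simp: abs_mult intro!: mult_mono)
  have int: "integrable M (\<lambda>x. g x * g x)" "integrable M (\<lambda>x. g x * k x)" "integrable M (\<lambda>x. k x * k x)"
    by (rule integrable_const_bound[where B = "C * C"], rule AE_I2, unfold real_norm_def,
        intro bd g k, assumption+, measurable)+
  have quad: "0 \<le> s\<^sup>2 * a - 2 * s * t * b + t\<^sup>2 * c" for s t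
  proof -
    have "0 \<le> (\<integral>x. (s * g x - t * k x)\<^sup>2 \<partial>M)" by simp
    also have "\<dots> = (\<integral>x. s\<^sup>2 * (g x * g x) - 2 * s * t * (g x * k x) + t\<^sup>2 * (k x * k x) \<partial>M)"
      by (simp add: power2_eq_square algebra_simps)
    also have "\<dots> = s\<^sup>2 * a - 2 * s * t * b + t\<^sup>2 * c"
      using int by (simp add: a_def b_def c_def)
    finally show ?thesis .
  qed
  have nn: "0 \<le> a" "0 \<le> c" by (auto simp: a_def c_def)
  \<comment> \<open>The choices \<open>(b, a)\<close> and \<open>(c, b)\<close> for
    \<open>(s, t)\<close> turn the form into \<open>a\<close> and \<open>c\<close> times
    \<open>a * c - b\<^sup>2\<close>, without any division.\<close>
  have "0 \<le> a * (a * c - b\<^sup>2)" "0 \<le> c * (a * c - b\<^sup>2)"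
    using quad[of b a] quad[of c b] by (simp_all add: power2_eq_square algebra_simps)
  \<comment> \<open>Only \<open>- 2 * s * t * b\<close> remains of the form; the two signs of
    \<open>t\<close> force \<open>b = 0\<close>.\<close>
  moreover have "b = 0" if "a = 0" "c = 0"
    using quad[of 1 1] quad[of 1 "-1"] that by simp
  ultimately have "b\<^sup>2 \<le> a * c"
  proof (cases "a = 0 \<and> c = 0")
    case False
    then have "0 < a \<or> 0 < c" using nn by auto
    with \<open>0 \<le> a * (a * c - b\<^sup>2)\<close> \<open>0 \<le> c * (a * c - b\<^sup>2)\<close> show ?thesis
      by (metis diff_ge_0_iff_ge zero_le_mult_iff not_less)
  qed auto
  then show ?thesis by (simp add: a_def b_def c_def)
qed

text \<open>Integrands are evaluated at reflected points such as
  \<open>\<lambda>v. x (\<phi> v)\<close>, which need not be extensional and so may lie outside the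
  product space. This property allows replacing such a point by its restriction to
  \<open>J\<close>.\<close>

definition depends_on :: "'i set \<Rightarrow> (('i \<Rightarrow> 'a) \<Rightarrow> 'b) \<Rightarrow> bool" where
  "depends_on J G \<longleftrightarrow> (\<forall>x y. (\<forall>i\<in>J. x i = y i) \<longrightarrow> G x = G y)"

lemma depends_onD: "depends_on J G \<Longrightarrow> (\<And>i. i \<in> J \<Longrightarrow> x i = y i) \<Longrightarrow> G x = G y"
  by (auto simp: depends_on_def)

text \<open>With the coordinates in \<open>F\<close> frozen, \<open>G\<close> sees only those in
  \<open>A\<close> and the reflected \<open>K\<close> only those in \<open>B\<close>, so by Fubini
  the inner integral is a product. Reindexing \<open>B\<close> by \<open>\<phi>\<close> brings the
  second factor to \<open>A\<close>.\<close>

lemma integral_PiM_swap: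
  fixes G K :: "('i \<Rightarrow> 'a) \<Rightarrow> real"
  assumes U: "prob_space U"
    and fin: "finite F" "finite A" "finite B"
    and disj: "F \<inter> A = {}" "F \<inter> B = {}" "A \<inter> B = {}"
    and \<phi>: "bij_betw \<phi> A B" "\<forall>v\<in>F. \<phi> v = v"
    and G: "G \<in> borel_measurable (\<Pi>\<^sub>M i\<in>F \<union> A. U)" "depends_on (F \<union> A) G" "\<And>x. \<bar>G x\<bar> \<le> C"
    and K: "K \<in> borel_measurable (\<Pi>\<^sub>M i\<in>F \<union> A. U)" "depends_on (F \<union> A) K" "\<And>x. \<bar>K x\<bar> \<le> C"
  shows "(\<integral>x. G x * K (\<lambda>v. x (\<phi> v)) \<partial>(\<Pi>\<^sub>M i\<in>F \<union> (A \<union> B). U)) =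
    (\<integral>z. (\<integral>y. G (merge F A (z, y)) \<partial>(\<Pi>\<^sub>M i\<in>A. U)) * (\<integral>y. K (merge F A (z, y)) \<partial>(\<Pi>\<^sub>M i\<in>A. U))
      \<partial>(\<Pi>\<^sub>M i\<in>F. U))"
proof -
  let ?P = "\<lambda>J. \<Pi>\<^sub>M i\<in>J. U"
  interpret U: prob_space U by fact
  interpret S: product_sigma_finite "\<lambda>_::'i. U" ..
  have P: "prob_space (?P J)" for J by (intro prob_space_PiM U)
  note [measurable] = G(1) K(1)
  have \<phi>B: "\<phi> v \<in> B" if "v \<in> A" for v using \<phi>(1) that by (auto simp: bij_betw_def)
  have bd: "\<bar>u * v\<bar> \<le> C * C" if "\<bar>u\<bar> \<le> C" "\<bar>v\<bar> \<le> C" for u v :: real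
    using that by (auto simp: abs_mult intro!: mult_mono)
  let ?f = "\<lambda>x. G x * K (\<lambda>v. x (\<phi> v))"
  have intI: "integrable (?P J) f" if "f \<in> borel_measurable (?P J)" "\<And>x. \<bar>f x\<bar> \<le> c" for J c and f :: "_ \<Rightarrow> real"
  proof -
    interpret prob_space "?P J" by (rule P)
    show ?thesis by (rule integrable_const_bound[where B = c]) (use that in auto)
  qed
  \<comment> \<open>Restriction puts both arguments into the product space over
    \<open>F \<union> A\<close>, where \<open>G\<close> and \<open>K\<close> are measurable, and
    leaves the values unchanged.\<close>
  have "(\<lambda>x. G (restrict x (F \<union> A)) * K (\<lambda>v\<in>F \<union> A. x (\<phi> v))) \<in> borel_measurable (?P (F \<union> (A \<union> B)))"
  proof -
    have [measurable]: "(\<lambda>x. restrict x (F \<union> A)) \<in> measurable (?P (F \<union> (A \<union> B))) (?P (F \<union> A))"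
      by (rule measurable_restrict_subset) auto
    have [measurable]: "(\<lambda>x. \<lambda>v\<in>F \<union> A. x (\<phi> v)) \<in> measurable (?P (F \<union> (A \<union> B))) (?P (F \<union> A))"
      using \<phi>B \<phi>(2) by (intro measurable_restrict measurable_component_singleton) auto
    show ?thesis by measurable
  qed
  moreover have "G (restrict x (F \<union> A)) = G x" "K (\<lambda>v\<in>F \<union> A. x (\<phi> v)) = K (\<lambda>v. x (\<phi> v))" for x
    by (auto intro!: depends_onD[OF G(2)] depends_onD[OF K(2)])
  ultimately have f[measurable]: "?f \<in> borel_measurable (?P (F \<union> (A \<union> B)))"
    by simp
  have fbd: "\<bar>?f x\<bar> \<le> C * C" for x by (intro bd G K)
  have eqG: "G (merge F (A \<union> B) (z, merge A B (y, w))) = G (merge F A (z, y))" for z y w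
    using disj by (intro depends_onD[OF G(2)]) (auto simp: merge_def)
  have eqK: "K (\<lambda>v. merge F (A \<union> B) (z, merge A B (y, w)) (\<phi> v)) = K (merge F A (z, \<lambda>v\<in>A. w (\<phi> v)))" for z y w
    using disj \<phi>B \<phi>(2) by (intro depends_onD[OF K(2)]) (auto simp: merge_def)
  have "(\<integral>x. ?f x \<partial>?P (F \<union> (A \<union> B))) = (\<integral>z. (\<integral>x. ?f (merge F (A \<union> B) (z, x)) \<partial>?P (A \<union> B)) \<partial>?P F)"
    using disj fin by (intro S.product_integral_fold intI[OF f fbd]) auto
  also have "\<dots> = (\<integral>z. (\<integral>y. G (merge F A (z, y)) \<partial>?P A) * (\<integral>y. K (merge F A (z, y)) \<partial>?P A) \<partial>?P F)"
  proof (rule Bochner_Integration.integral_cong[OF refl])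
    fix z assume z: "z \<in> space (?P F)"
    have mz[measurable]: "(\<lambda>x. merge F J (z, x)) \<in> measurable (?P J) (?P (F \<union> J))" for J
      using z by measurable
    have "(\<lambda>x. ?f (merge F (A \<union> B) (z, x))) \<in> borel_measurable (?P (A \<union> B))"
      using measurable_compose[OF mz f] by simp
    then have "(\<integral>x. ?f (merge F (A \<union> B) (z, x)) \<partial>?P (A \<union> B)) =
      (\<integral>y. (\<integral>w. ?f (merge F (A \<union> B) (z, merge A B (y, w))) \<partial>?P B) \<partial>?P A)"
      using disj fin by (intro S.product_integral_fold intI[OF _ fbd]) auto
    also have "\<dots> = (\<integral>y. G (merge F A (z, y)) * (\<integral>w. K (merge F A (z, \<lambda>v\<in>A. w (\<phi> v))) \<partial>?P B) \<partial>?P A)"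
      unfolding eqG eqK by simp
    also have "\<dots> = (\<integral>y. G (merge F A (z, y)) \<partial>?P A) * (\<integral>w. K (merge F A (z, \<lambda>v\<in>A. w (\<phi> v))) \<partial>?P B)"
      by simp
    also have "(\<integral>w. K (merge F A (z, \<lambda>v\<in>A. w (\<phi> v))) \<partial>?P B) =
      (\<integral>y. K (merge F A (z, y)) \<partial>distr (?P B) (?P A) (\<lambda>w. \<lambda>v\<in>A. w (\<phi> v)))"
    proof (rule integral_distr[symmetric])
      show "(\<lambda>w. \<lambda>v\<in>A. w (\<phi> v)) \<in> measurable (?P B) (?P A)"
        using \<phi>B by (intro measurable_restrict measurable_component_singleton) auto
    qed measurable
    also have "distr (?P B) (?P A) (\<lambda>w. \<lambda>v\<in>A. w (\<phi> v)) = ?P A"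
      using \<phi>(1) U by (intro distr_PiM_reindex) (auto simp: bij_betw_def)
    finally show "(\<integral>x. ?f (merge F (A \<union> B) (z, x)) \<partial>?P (A \<union> B)) =
      (\<integral>y. G (merge F A (z, y)) \<partial>?P A) * (\<integral>y. K (merge F A (z, y)) \<partial>?P A)" .
  qed
  finally show ?thesis .
qed

text \<open>
  Both sides of the cut are moved to \<open>A\<close>; integrating out the coordinates in \<open>A\<close> leaves the
  Cauchy-Schwarz inequality for two functions of the coordinates in \<open>F\<close>.
\<close>

lemma cut_Cauchy_Schwarz:
  fixes G H :: "('i \<Rightarrow> 'a) \<Rightarrow> real"
  assumes U: "prob_space U"
    and fin: "finite F" "finite A" "finite B"
    and disj: "F \<inter> A = {}" "F \<inter> B = {}" "A \<inter> B = {}"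
    and \<phi>: "bij_betw \<phi> A B" "\<And>v. v \<in> F \<Longrightarrow> \<phi> v = v" "\<And>v. v \<in> A \<union> B \<Longrightarrow> \<phi> (\<phi> v) = v"
    and G: "G \<in> borel_measurable (\<Pi>\<^sub>M i\<in>F \<union> A. U)" "depends_on (F \<union> A) G" "\<And>x. \<bar>G x\<bar> \<le> C"
    and H: "H \<in> borel_measurable (\<Pi>\<^sub>M i\<in>F \<union> B. U)" "depends_on (F \<union> B) H" "\<And>x. \<bar>H x\<bar> \<le> C"
  defines "P \<equiv> \<Pi>\<^sub>M i\<in>F \<union> (A \<union> B). U"
  shows "(\<integral>x. G x * H x \<partial>P)\<^sup>2 \<le>
    (\<integral>x. G x * G (\<lambda>v. x (\<phi> v)) \<partial>P) * (\<integral>x. H x * H (\<lambda>v. x (\<phi> v)) \<partial>P)"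
proof -
  let ?P = "\<lambda>J. \<Pi>\<^sub>M i\<in>J. U"
  let ?K = "\<lambda>x. H (\<lambda>v. x (\<phi> v))"
  have mem: "\<phi> v \<in> B" if "v \<in> A" for v using \<phi>(1) that by (auto simp: bij_betw_def)
  have mem': "\<phi> v \<in> A" if "v \<in> B" for v using \<phi>(1,3) that by (auto simp: bij_betw_def)
  have "(\<lambda>x. H (\<lambda>v\<in>F \<union> B. x (\<phi> v))) \<in> borel_measurable (?P (F \<union> A))"
  proof (rule measurable_compose[OF _ H(1)])
    show "(\<lambda>x. \<lambda>v\<in>F \<union> B. x (\<phi> v)) \<in> measurable (?P (F \<union> A)) (?P (F \<union> B))"
      using mem' \<phi>(2) by (intro measurable_restrict measurable_component_singleton) auto
  qed
  moreover have "H (\<lambda>v\<in>F \<union> B. x (\<phi> v)) = ?K x" for x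
    by (auto intro!: depends_onD[OF H(2)])
  ultimately have Km[measurable]: "?K \<in> borel_measurable (?P (F \<union> A))" by simp
  have Kd: "depends_on (F \<union> A) ?K"
    unfolding depends_on_def using mem' \<phi>(2) by (auto intro!: depends_onD[OF H(2)])
  \<comment> \<open>Reflecting \<open>?K\<close> once more gives back \<open>H\<close>, so
    \<open>H\<close> itself can be the reflected factor in \<open>swap\<close>.\<close>
  have H_eq: "H (\<lambda>v. x (\<phi> (\<phi> v))) = H x" for x
    using \<phi>(2,3) by (intro depends_onD[OF H(2)]) auto
  note [measurable] = G(1)
  have \<phi>F: "\<forall>v\<in>F. \<phi> v = v" using \<phi>(2) by simp
  note swap = integral_PiM_swap[OF U fin disj \<phi>(1) \<phi>F]
  let ?g = "\<lambda>z. \<integral>y. G (merge F A (z, y)) \<partial>?P A"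
  let ?k = "\<lambda>z. \<integral>y. ?K (merge F A (z, y)) \<partial>?P A"
  have GG: "(\<integral>x. G x * G (\<lambda>v. x (\<phi> v)) \<partial>P) = (\<integral>z. ?g z * ?g z \<partial>?P F)"
    unfolding P_def by (rule swap[OF G G])
  have GH: "(\<integral>x. G x * H x \<partial>P) = (\<integral>z. ?g z * ?k z \<partial>?P F)"
    using swap[OF G Km Kd H(3)] unfolding P_def H_eq .
  have HH: "(\<integral>x. H x * H (\<lambda>v. x (\<phi> v)) \<partial>P) = (\<integral>z. ?k z * ?k z \<partial>?P F)"
    using swap[OF Km Kd H(3) Km Kd H(3)] unfolding P_def H_eq by (simp add: mult.commute)
  interpret PF: prob_space "?P F" by (intro prob_space_PiM U)
  interpret PA: prob_space "?P A" by (intro prob_space_PiM U)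
  have bd: "\<bar>\<integral>y. f y \<partial>?P A\<bar> \<le> C" if "\<And>y. \<bar>f y\<bar> \<le> C" "f \<in> borel_measurable (?P A)" for f :: "_ \<Rightarrow> real"
  proof -
    have "integrable (?P A) f" by (rule PA.integrable_const_bound[where B = C]) (use that in auto)
    then have "\<bar>\<integral>y. f y \<partial>?P A\<bar> \<le> (\<integral>y. \<bar>f y\<bar> \<partial>?P A)" by (intro integral_abs_bound)
    also have "\<dots> \<le> (\<integral>y. C \<partial>?P A)"
      using \<open>integrable _ f\<close> that by (intro integral_mono) auto
    finally show ?thesis by (simp add: PA.prob_space)
  qed
  show ?thesis unfolding GG GH HH
  proof (rule PF.Cauchy_Schwarz_bounded[where C = C])
    \<comment> \<open>Joint measurability is what makes the inner integrals measurable in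
      \<open>z\<close>.\<close>
    have 1: "(\<lambda>(z, y). G (merge F A (z, y))) \<in> borel_measurable (?P F \<Otimes>\<^sub>M ?P A)"
      "(\<lambda>(z, y). ?K (merge F A (z, y))) \<in> borel_measurable (?P F \<Otimes>\<^sub>M ?P A)"
      using measurable_compose[OF measurable_merge G(1)] measurable_compose[OF measurable_merge Km] by (auto simp: split_beta')
    show "?g \<in> borel_measurable (?P F)" "?k \<in> borel_measurable (?P F)"
      using 1[THEN PA.borel_measurable_lebesgue_integral] by simp_all
    fix z assume z: "z \<in> space (?P F)"
    then show "\<bar>?g z\<bar> \<le> C" "\<bar>?k z\<bar> \<le> C"
      using 1[THEN measurable_Pair2, OF z] by (auto intro!: bd G H)
  qed
qed

section \<open>Folding edge-indexed kernels\<close>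

definition directed_edges :: "'v set set \<Rightarrow> 'v set \<Rightarrow> 'v set \<Rightarrow> ('v \<times> 'v) set" where
  "directed_edges E A B = {(a, b). a \<in> A \<and> b \<in> B \<and> {a, b} \<in> E}"

text \<open>The multilinear form behind the norm. Separate kernels on the edges let a folding act by
  reindexing \<open>\<alpha>\<close>. The product measure is left uncompleted, so that Fubini
  applies directly.\<close>

definition graph_integral ::
    "'a measure \<Rightarrow> 'v set \<Rightarrow> ('v \<times> 'v) set \<Rightarrow> ('v \<times> 'v \<Rightarrow> 'a \<times> 'a \<Rightarrow> real) \<Rightarrow> real" where
  "graph_integral U V D \<alpha> = (\<integral>x. (\<Prod>d\<in>D. \<alpha> d (map_prod x x d)) \<partial>(\<Pi>\<^sub>M i\<in>V. U))"

section \<open>Bipartitions, vertex cuts and the sides of a cut involution\<close>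

lemma bipartition_edge:
  assumes "bipartition V E A B" "{u, v} \<in> E"
  shows "u \<in> A \<longleftrightarrow> v \<in> B" "u \<in> B \<longleftrightarrow> v \<in> A"
proof -
  obtain a b where "a \<in> A" "b \<in> B" "{u, v} = {a, b}" and "A \<inter> B = {}"
    using assms unfolding bipartition_def by blast
  then show "u \<in> A \<longleftrightarrow> v \<in> B" "u \<in> B \<longleftrightarrow> v \<in> A"
    by (auto simp: doubleton_eq_iff)
qed

text \<open>As \<open>A\<close> and \<open>B\<close> are disjoint, forgetting directions is a
  bijection onto \<open>E\<close>.\<close>

lemma
  assumes "simple_graph V E" "bipartition V E A B"
  shows finite_directed_edges: "finite (directed_edges E A B)"
    and card_directed_edges: "card (directed_edges E A B) = card E"
proof -
  have "bij_betw (\<lambda>(a, b). {a, b}) (directed_edges E A B) E"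
    unfolding bij_betw_def
  proof
    show "inj_on (\<lambda>(a, b). {a, b}) (directed_edges E A B)"
      using assms(2) by (auto simp: inj_on_def directed_edges_def bipartition_def doubleton_eq_iff)
    show "(\<lambda>(a, b). {a, b}) ` directed_edges E A B = E"
      using assms(2) unfolding bipartition_def directed_edges_def by fastforce
  qed
  moreover have "finite E"
    using assms(1) unfolding simple_graph_def
    by (auto intro: finite_subset[of E "Pow V"])
  ultimately show "finite (directed_edges E A B)" "card (directed_edges E A B) = card E"
    by (auto simp: bij_betw_finite bij_betw_same_card)
qed

text \<open>Removing nothing from a connected graph leaves a single component. The vertex obtained
  here is a fixed point of the involution, which later anchors the bipartition.\<close>

lemma vertex_cut_nonempty:
  assumes "graph_connected V E" "vertex_cut V E F"
  shows "F \<noteq> {}"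
proof
  assume "F = {}"
  with assms(2) have "2 \<le> card (components_on E V)"
    by (simp add: vertex_cut_def)
  moreover have "(induced_adj E V)\<^sup>* \<inter> V \<times> V = V \<times> V"
    using assms(1) by (auto simp: graph_connected_def)
  moreover have "V // (V \<times> V) \<subseteq> {V}"
    by (auto simp: quotient_def)
  then have "card (V // (V \<times> V)) \<le> 1"
    using card_mono[of "{V}"] by fastforce
  ultimately show False by (simp add: components_on_def)
qed

lemma cut_sidesD:
  assumes "cut_sides V E \<phi> P Q"
  shows "P \<inter> Q = {}" "P \<union> Q = V - fixed_points V \<phi>" "\<phi> ` P = Q"
  using assms unfolding cut_sides_def by blast+

text \<open>An edge from \<open>u\<close> to \<open>v\<close> would put \<open>v\<close> into the
  component of \<open>u\<close>, and that component lies inside \<open>P\<close>.\<close>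

lemma cut_sides_nonadjacent:
  assumes sides: "cut_sides V E \<phi> P Q" and "u \<in> P" "v \<in> Q"
  shows "{u, v} \<notin> E"
proof
  assume uv: "{u, v} \<in> E"
  let ?W = "V - fixed_points V \<phi>"
  let ?r = "(induced_adj E ?W)\<^sup>* \<inter> ?W \<times> ?W"
  from sides obtain X where X: "X \<in> components_on E ?W" "u \<in> X" "X \<subseteq> P"
    using \<open>u \<in> P\<close> unfolding cut_sides_def by blast
  then obtain w where w: "X = ?r `` {w}" by (auto simp: components_on_def quotient_def)
  have "v \<in> ?W" using cut_sidesD(2)[OF sides] \<open>v \<in> Q\<close> by blast
  moreover have "u \<in> ?W" using cut_sidesD(2)[OF sides] \<open>u \<in> P\<close> by blast
  ultimately have "(u, v) \<in> induced_adj E ?W" using uv by (auto simp: induced_adj_def)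
  with X(2) \<open>v \<in> ?W\<close> have "v \<in> X" unfolding w by auto
  with X(3) \<open>v \<in> Q\<close> cut_sidesD(1)[OF sides] show False by blast
qed

text \<open>Along a path from the fixed vertex \<open>v0\<close>, every edge changes the side of the
  current vertex and of its image simultaneously. An automorphism without fixed vertices might
  exchange \<open>A\<close> and \<open>B\<close>.\<close>

lemma graph_auto_preserves_sides:
  assumes conn: "graph_connected V E" and bip: "bipartition V E A B"
    and \<phi>: "\<phi> \<in> graph_auto V E" and v0: "v0 \<in> V" "\<phi> v0 = v0" and "v \<in> V"
  shows "\<phi> v \<in> A \<longleftrightarrow> v \<in> A"
proof -
  have \<phi>V: "\<phi> w \<in> V" if "w \<in> V" for w
    using \<phi> that by (auto simp: graph_auto_def Bij_def bij_betw_def)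
  have "(v0, v) \<in> (induced_adj E V)\<^sup>*"
    using conn v0 \<open>v \<in> V\<close> by (auto simp: graph_connected_def)
  then show ?thesis
  proof induction
    case base
    then show ?case using v0 by simp
  next
    case (step y z)
    then have yz: "y \<in> V" "z \<in> V" "{y, z} \<in> E" by (auto simp: induced_adj_def)
    then have "{\<phi> y, \<phi> z} \<in> E" using \<phi> by (auto simp: graph_auto_def)
    from bipartition_edge[OF bip this] bipartition_edge[OF bip yz(3)] step.IH
    show ?case using yz \<phi>V bip by (auto simp: bipartition_def)
  qed
qed

text \<open>These are the three properties that \<open>cut_Cauchy_Schwarz\<close> asks of its
  integrands; the bound also yields integrability.\<close>

lemma edge_prod:
  fixes \<alpha> :: "'v \<times> 'v \<Rightarrow> 'a \<times> 'a \<Rightarrow> real"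
  assumes T: "\<And>d. d \<in> T \<Longrightarrow> fst d \<in> S \<and> snd d \<in> S"
    and \<alpha>: "\<And>d. \<alpha> d \<in> borel_measurable (U \<Otimes>\<^sub>M U)" and C: "\<And>d p. \<bar>\<alpha> d p\<bar> \<le> C"
  defines "G \<equiv> \<lambda>x. \<Prod>d\<in>T. \<alpha> d (map_prod x x d)"
  shows "G \<in> borel_measurable (\<Pi>\<^sub>M i\<in>S. U)" "depends_on S G" "\<bar>G x\<bar> \<le> C ^ card T"
proof -
  have "(\<lambda>x. \<alpha> d (map_prod x x d)) \<in> borel_measurable (\<Pi>\<^sub>M i\<in>S. U)" if "d \<in> T" for d
  proof (rule measurable_compose[OF _ \<alpha>])
    have "(\<lambda>x. (x (fst d), x (snd d))) \<in> measurable (\<Pi>\<^sub>M i\<in>S. U) (U \<Otimes>\<^sub>M U)"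
      using T[OF that] by (intro measurable_Pair measurable_component_singleton) auto
    then show "(\<lambda>x. map_prod x x d) \<in> measurable (\<Pi>\<^sub>M i\<in>S. U) (U \<Otimes>\<^sub>M U)"
      by (simp add: map_prod_def split_beta')
  qed
  then show "G \<in> borel_measurable (\<Pi>\<^sub>M i\<in>S. U)"
    unfolding G_def by (intro borel_measurable_prod)
  show "depends_on S G"
    unfolding depends_on_def G_def using T by (auto intro!: prod.cong simp: map_prod_def split_beta')
  have "\<bar>G x\<bar> \<le> (\<Prod>d\<in>T. C)"
    unfolding G_def abs_prod by (intro prod_mono) (auto simp: C)
  then show "\<bar>G x\<bar> \<le> C ^ card T" by simp
qed

section \<open>Folding along one stable involution\<close>

locale stable_fold =
  fixes V :: "'v set" and E :: "'v set set" and A B :: "'v set"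
    and \<phi> :: "'v \<Rightarrow> 'v" and P Q :: "'v set"
  assumes graph: "simple_graph V E" and conn: "graph_connected V E"
    and bip: "bipartition V E A B"
    and stable: "stable_involution V E \<phi>" and sides: "cut_sides V E \<phi> P Q"
begin

abbreviation "F \<equiv> fixed_points V \<phi>"

abbreviation "D \<equiv> directed_edges E A B"

lemma automorphism: "\<phi> \<in> graph_auto V E" and invol: "v \<in> V \<Longrightarrow> \<phi> (\<phi> v) = v"
  and cut: "vertex_cut V E F" and indep: "u \<in> F \<Longrightarrow> v \<in> F \<Longrightarrow> {u, v} \<notin> E"
  using stable by (auto simp: stable_involution_def cut_involution_def independent_set_def)

lemma in_V: "v \<in> V \<Longrightarrow> \<phi> v \<in> V"
  using automorphism by (auto simp: graph_auto_def Bij_def bij_betw_def)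

lemma parts: "V = F \<union> (P \<union> Q)" "F \<inter> P = {}" "F \<inter> Q = {}" "P \<inter> Q = {}"
  using cut_sidesD(1,2)[OF sides] fixed_points_def[of V \<phi>] by blast+

lemma finite_parts: "finite F" "finite P" "finite Q"
proof -
  have *: "finite V" using graph by (simp add: simple_graph_def)
  show "finite F" "finite P" "finite Q"
    using parts(1) * by (metis finite_Un)+
qed

lemma PQ_subset: "P \<subseteq> V" "Q \<subseteq> V"
  using cut_sidesD(2)[OF sides] by blast+

lemma bij_PQ: "bij_betw \<phi> P Q"
proof -
  have "inj_on \<phi> P" using PQ_subset by (intro inj_on_inverseI[of _ \<phi>]) (auto intro: invol)
  then show ?thesis using sides by (simp add: bij_betw_def cut_sides_def)
qed

text \<open>Since \<open>\<phi>\<close> is an involution, the two sides are interchangeable; every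
  fact about folding \<open>Q\<close> onto \<open>P\<close> thus also covers the opposite
  folding.\<close>

lemma swap_sides: "stable_fold V E A B \<phi> Q P"
proof -
  have "\<phi> ` P = Q" using sides by (simp add: cut_sides_def)
  then have "\<phi> ` Q = (\<lambda>v. \<phi> (\<phi> v)) ` P" by auto
  also have "\<dots> = (\<lambda>v. v) ` P" using PQ_subset by (intro image_cong) (auto simp: invol)
  finally have "\<phi> ` Q = P" by simp
  with sides have "cut_sides V E \<phi> Q P" unfolding cut_sides_def by (simp add: Int_commute Un_commute)
  then show ?thesis using graph conn bip stable by unfold_locales
qed

lemma preserves: "v \<in> V \<Longrightarrow> \<phi> v \<in> A \<longleftrightarrow> v \<in> A" "v \<in> V \<Longrightarrow> \<phi> v \<in> B \<longleftrightarrow> v \<in> B"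
proof -
  from vertex_cut_nonempty[OF conn cut] obtain v0 where "v0 \<in> V" "\<phi> v0 = v0"
    by (auto simp: fixed_points_def)
  from graph_auto_preserves_sides[OF conn bip automorphism this]
  show A: "v \<in> V \<Longrightarrow> \<phi> v \<in> A \<longleftrightarrow> v \<in> A" for v .
  show "v \<in> V \<Longrightarrow> \<phi> v \<in> B \<longleftrightarrow> v \<in> B"
    using A[of v] in_V[of v] bip by (auto simp: bipartition_def)
qed

lemma D_in_V: "d \<in> D \<Longrightarrow> fst d \<in> V \<and> snd d \<in> V"
  using bip by (auto simp: directed_edges_def bipartition_def)

lemma D_image: "d \<in> D \<Longrightarrow> map_prod \<phi> \<phi> d \<in> D"
  using D_in_V[of d] automorphism preserves by (auto simp: directed_edges_def graph_auto_def)

definition "side_edges S = {d \<in> D. fst d \<in> F \<union> S \<and> snd d \<in> F \<union> S}"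

text \<open>No edge joins \<open>P\<close> to \<open>Q\<close>, so every edge lies in
  \<open>F \<union> P\<close> or in \<open>F \<union> Q\<close>. An edge in both would have its two
  ends in \<open>F\<close>, which stability excludes.\<close>

lemma D_split: "D = side_edges P \<union> side_edges Q" "side_edges P \<inter> side_edges Q = {}"
proof -
  have "d \<in> side_edges P \<union> side_edges Q" if "d \<in> D" for d
  proof -
    obtain u v where d: "d = (u, v)" by fastforce
    have uv: "{u, v} \<in> E" using that by (auto simp: d directed_edges_def)
    have "u \<in> F \<union> (P \<union> Q)" "v \<in> F \<union> (P \<union> Q)"
      using D_in_V[OF that] parts(1) d by (metis fst_conv, metis snd_conv)
    moreover have "\<not> (u \<in> P \<and> v \<in> Q)" "\<not> (u \<in> Q \<and> v \<in> P)"
      using cut_sides_nonadjacent[OF sides, of u v] cut_sides_nonadjacent[OF sides, of v u] uv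
      by (auto simp: insert_commute)
    ultimately show ?thesis using that by (auto simp: side_edges_def d)
  qed
  then show "D = side_edges P \<union> side_edges Q" by (auto simp: side_edges_def)
  have "d \<notin> side_edges Q" if "d \<in> side_edges P" for d
    using that parts(2-4) indep[of "fst d" "snd d"]
    by (auto simp: side_edges_def directed_edges_def)
  then show "side_edges P \<inter> side_edges Q = {}" by blast
qed

lemma bij_side_edges: "bij_betw (map_prod \<phi> \<phi>) (side_edges P) (side_edges Q)"
proof (rule bij_betwI[where g = "map_prod \<phi> \<phi>"])
  have fixed: "v \<in> F \<Longrightarrow> \<phi> v = v" for v by (simp add: fixed_points_def)
  have PQ: "v \<in> P \<Longrightarrow> \<phi> v \<in> Q" for v using bij_PQ by (auto simp: bij_betw_def)
  have QP: "v \<in> Q \<Longrightarrow> \<phi> v \<in> P" for v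
    using bij_PQ PQ_subset invol by (force simp: bij_betw_def)
  show "map_prod \<phi> \<phi> \<in> side_edges P \<rightarrow> side_edges Q"
    "map_prod \<phi> \<phi> \<in> side_edges Q \<rightarrow> side_edges P"
    using D_image by (auto simp: side_edges_def fixed dest: PQ QP)
  show "map_prod \<phi> \<phi> (map_prod \<phi> \<phi> d) = d" if "d \<in> side_edges P" for d
    using that D_in_V[of d] by (cases d) (auto simp: side_edges_def invol)
  show "map_prod \<phi> \<phi> (map_prod \<phi> \<phi> d) = d" if "d \<in> side_edges Q" for d
    using that D_in_V[of d] by (cases d) (auto simp: side_edges_def invol)
qed

abbreviation "fold_edge \<equiv> map_prod (fold_map Q \<phi>) (fold_map Q \<phi>)"

lemma fold_edge_P: "d \<in> side_edges P \<Longrightarrow> fold_edge d = d"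
  using parts(2-4) by (cases d) (auto simp: side_edges_def fold_map_def)

lemma fold_edge_Q: "d \<in> side_edges Q \<Longrightarrow> fold_edge d = map_prod \<phi> \<phi> d"
  by (cases d) (auto simp: side_edges_def fold_map_def fixed_points_def)

lemma fold_edge_in_D: "d \<in> D \<Longrightarrow> fold_edge d \<in> D"
  using D_split(1) fold_edge_P fold_edge_Q D_image by (metis Un_iff)

text \<open>Folding fixes the edges on the side of \<open>P\<close> and reflects those on the side
  of \<open>Q\<close>. Reindexing the latter by \<open>\<phi>\<close> repeats the first product at
  the reflected point, which is the shape of the factors in
  \<open>cut_Cauchy_Schwarz\<close>.\<close>

lemma prod_fold:
  fixes \<alpha> :: "'v \<times> 'v \<Rightarrow> 'a \<times> 'a \<Rightarrow> real"
  shows "(\<Prod>d\<in>D. \<alpha> (fold_edge d) (map_prod x x d)) =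
    (\<Prod>d\<in>side_edges P. \<alpha> d (map_prod x x d)) *
    (\<Prod>d\<in>side_edges P. \<alpha> d (map_prod (\<lambda>v. x (\<phi> v)) (\<lambda>v. x (\<phi> v)) d))"
proof -
  have fin: "finite (side_edges P)" "finite (side_edges Q)"
    using finite_directed_edges[OF graph bip] by (auto simp: side_edges_def)
  have "(\<Prod>d\<in>D. \<alpha> (fold_edge d) (map_prod x x d)) =
    (\<Prod>d\<in>side_edges P. \<alpha> (fold_edge d) (map_prod x x d)) *
    (\<Prod>d\<in>side_edges Q. \<alpha> (fold_edge d) (map_prod x x d))"
    unfolding D_split(1) by (rule prod.union_disjoint[OF fin D_split(2)])
  also have "(\<Prod>d\<in>side_edges Q. \<alpha> (fold_edge d) (map_prod x x d)) =
    (\<Prod>d\<in>side_edges Q. \<alpha> (map_prod \<phi> \<phi> d) (map_prod x x d))"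
    by (intro prod.cong) (simp_all add: fold_edge_Q)
  also have "\<dots> = (\<Prod>d\<in>side_edges P. \<alpha> (map_prod \<phi> \<phi> (map_prod \<phi> \<phi> d)) (map_prod x x (map_prod \<phi> \<phi> d)))"
    by (rule prod.reindex_bij_betw[OF bij_side_edges, symmetric])
  also have "\<dots> = (\<Prod>d\<in>side_edges P. \<alpha> d (map_prod (\<lambda>v. x (\<phi> v)) (\<lambda>v. x (\<phi> v)) d))"
  proof (intro prod.cong refl)
    fix d assume "d \<in> side_edges P"
    then have "map_prod \<phi> \<phi> (map_prod \<phi> \<phi> d) = d"
      using D_in_V[of d] by (cases d) (auto simp: side_edges_def invol)
    then show "\<alpha> (map_prod \<phi> \<phi> (map_prod \<phi> \<phi> d)) (map_prod x x (map_prod \<phi> \<phi> d)) =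
      \<alpha> d (map_prod (\<lambda>v. x (\<phi> v)) (\<lambda>v. x (\<phi> v)) d)"
      by (cases d) simp
  qed
  also have "(\<Prod>d\<in>side_edges P. \<alpha> (fold_edge d) (map_prod x x d)) =
    (\<Prod>d\<in>side_edges P. \<alpha> d (map_prod x x d))"
    by (intro prod.cong) (simp_all add: fold_edge_P)
  finally show ?thesis .
qed

text \<open>The exponent is enlarged to \<open>card D\<close>, using \<open>1 \<le> C\<close>,
  because \<open>cut_Cauchy_Schwarz\<close> needs one bound for both sides.\<close>

lemma side_prod:
  fixes \<alpha> :: "'v \<times> 'v \<Rightarrow> 'a \<times> 'a \<Rightarrow> real" and S :: "'v set"
  assumes \<alpha>: "\<And>d. \<alpha> d \<in> borel_measurable (U \<Otimes>\<^sub>M U)" and C: "\<And>d p. \<bar>\<alpha> d p\<bar> \<le> C" "1 \<le> C"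
  defines "G \<equiv> \<lambda>x. \<Prod>d\<in>side_edges S. \<alpha> d (map_prod x x d)"
  shows "G \<in> borel_measurable (\<Pi>\<^sub>M i\<in>F \<union> S. U)" "depends_on (F \<union> S) G" "\<bar>G x\<bar> \<le> C ^ card D"
proof -
  have T: "fst d \<in> F \<union> S \<and> snd d \<in> F \<union> S" if "d \<in> side_edges S" for d
    using that by (simp add: side_edges_def)
  show "G \<in> borel_measurable (\<Pi>\<^sub>M i\<in>F \<union> S. U)" "depends_on (F \<union> S) G"
    unfolding G_def by (rule edge_prod[where \<alpha> = \<alpha>, OF T \<alpha> C(1)]; assumption)+
  have "\<bar>G x\<bar> \<le> C ^ card (side_edges S)"
    unfolding G_def by (rule edge_prod[where \<alpha> = \<alpha>, OF T \<alpha> C(1)])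
  also have "\<dots> \<le> C ^ card D"
    using finite_directed_edges[OF graph bip] C(2)
    by (auto simp: side_edges_def intro!: power_increasing card_mono)
  finally show "\<bar>G x\<bar> \<le> C ^ card D" .
qed

text \<open>The integrand is the product over \<open>side_edges P\<close> times the product over
  \<open>side_edges Q\<close>. Cauchy-Schwarz pairs each with its own reflection, and
  \<open>prod_fold\<close>, used for both orders of the sides, recognises the folded
  kernels.\<close>

lemma graph_integral_fold:
  fixes \<alpha> :: "'v \<times> 'v \<Rightarrow> 'a \<times> 'a \<Rightarrow> real"
  assumes U: "prob_space U"
    and \<alpha>: "\<And>d. \<alpha> d \<in> borel_measurable (U \<Otimes>\<^sub>M U)" and C: "\<And>d p. \<bar>\<alpha> d p\<bar> \<le> C" "1 \<le> C"
  shows "(graph_integral U V D \<alpha>)\<^sup>2 \<le>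
    graph_integral U V D (\<lambda>d. \<alpha> (map_prod (fold_map Q \<phi>) (fold_map Q \<phi>) d)) *
    graph_integral U V D (\<lambda>d. \<alpha> (map_prod (fold_map P \<phi>) (fold_map P \<phi>) d))"
proof -
  interpret swap: stable_fold V E A B \<phi> Q P by (rule swap_sides)
  have fin: "finite (side_edges P)" "finite (side_edges Q)"
    using finite_directed_edges[OF graph bip] by (auto simp: side_edges_def)
  let ?G = "\<lambda>S x. \<Prod>d\<in>side_edges S. \<alpha> d (map_prod x x d)"
  have "(\<integral>x. ?G P x * ?G Q x \<partial>(\<Pi>\<^sub>M i\<in>F \<union> (P \<union> Q). U))\<^sup>2 \<le>
    (\<integral>x. ?G P x * ?G P (\<lambda>v. x (\<phi> v)) \<partial>(\<Pi>\<^sub>M i\<in>F \<union> (P \<union> Q). U)) *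
    (\<integral>x. ?G Q x * ?G Q (\<lambda>v. x (\<phi> v)) \<partial>(\<Pi>\<^sub>M i\<in>F \<union> (P \<union> Q). U))"
    using PQ_subset
    by (intro cut_Cauchy_Schwarz[OF U finite_parts parts(2-4) bij_PQ _ _
          side_prod[where \<alpha> = \<alpha>, OF \<alpha> C] side_prod[where \<alpha> = \<alpha>, OF \<alpha> C]] invol)
      (auto simp: fixed_points_def)
  moreover have "(\<Prod>d\<in>D. \<alpha> d (map_prod x x d)) = ?G P x * ?G Q x" for x
    unfolding D_split(1) by (rule prod.union_disjoint[OF fin D_split(2)])
  ultimately show ?thesis
    unfolding graph_integral_def prod_fold[of \<alpha>] swap.prod_fold[of \<alpha>] parts(1)[symmetric] by simp
qed

end

section \<open>Percolation\<close>

lemma graph_integral_cong: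
  "(\<And>d. d \<in> D \<Longrightarrow> \<alpha> d = \<beta> d) \<Longrightarrow> graph_integral U V D \<alpha> = graph_integral U V D \<beta>"
  by (simp add: graph_integral_def)

text \<open>Naming the folded side \<open>Q\<close> merges left and right foldings into one
  case.\<close>

lemma strong_percolating_step:
  assumes "strong_percolating_sequence V E L R J N" "i < N"
    and "simple_graph V E" "graph_connected V E" "bipartition V E A B"
  obtains \<phi> P Q where "stable_fold V E A B \<phi> P Q" "J (Suc i) = pull_edges E (fold_map Q \<phi>) (J i)"
proof -
  obtain \<phi> where \<phi>: "stable_involution V E \<phi>" "cut_sides V E \<phi> (L \<phi>) (R \<phi>)"
    and J: "J (Suc i) = pull_edges E (fold_map (R \<phi>) \<phi>) (J i) \<or>
      J (Suc i) = pull_edges E (fold_map (L \<phi>) \<phi>) (J i)"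
    using assms(1,2) unfolding strong_percolating_sequence_def percolating_sequence_via_def by blast
  have *: "stable_fold V E A B \<phi> (L \<phi>) (R \<phi>)"
    using assms \<phi> by unfold_locales
  from J show thesis
    using that[OF *] that[OF stable_fold.swap_sides[OF *]] by blast
qed

text \<open>
  By the folding inequality, folding a colouring with maximal integral gives two colourings with
  maximal integral. Percolation therefore leads from any maximiser to a constant one.
\<close>

lemma graph_integral_two_colours:
  fixes f g :: "'a \<times> 'a \<Rightarrow> real"
  assumes U: "prob_space U"
    and G: "simple_graph V E" "graph_connected V E" "bipartition V E A B"
    and perc: "strong_percolating_sequence V E L R J N"
    and meas: "f \<in> borel_measurable (U \<Otimes>\<^sub>M U)" "g \<in> borel_measurable (U \<Otimes>\<^sub>M U)"
    and C: "\<And>p. \<bar>f p\<bar> \<le> C" "\<And>p. \<bar>g p\<bar> \<le> C"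
  defines "D \<equiv> directed_edges E A B"
  assumes f: "\<bar>graph_integral U V D (\<lambda>_. f)\<bar> \<le> 1"
    and g: "\<bar>graph_integral U V D (\<lambda>_. g)\<bar> \<le> 1"
    and "S \<subseteq> D"
  shows "\<bar>graph_integral U V D (\<lambda>d. if d \<in> S then f else g)\<bar> \<le> 1"
proof -
  define val where "val T = \<bar>graph_integral U V D (\<lambda>d. if d \<in> T then f else g)\<bar>" for T
  define M where "M = Max (val ` Pow D)"
  have fin: "finite D" unfolding D_def by (rule finite_directed_edges[OF G(1,3)])
  have val_le: "val T \<le> M" if "T \<subseteq> D" for T
    unfolding M_def using that fin by (intro Max_ge) auto
  have "M \<in> val ` Pow D" unfolding M_def using fin by (intro Max_in) auto
  then obtain S0 where S0: "S0 \<subseteq> D" "val S0 = M" by auto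
  have "M \<le> 1"
  proof (rule ccontr)
    assume "\<not> M \<le> 1"
    then have "0 < M" by simp
    have fold: "val {d \<in> D. map_prod (fold_map Q \<phi>) (fold_map Q \<phi>) d \<in> T} = M"
      if "stable_fold V E A B \<phi> P Q" "T \<subseteq> D" "val T = M" for \<phi> P Q T
    proof -
      interpret stable_fold V E A B \<phi> P Q by fact
      let ?T = "\<lambda>X. {d \<in> D. map_prod (fold_map X \<phi>) (fold_map X \<phi>) d \<in> T}"
      let ?\<alpha> = "\<lambda>d. if d \<in> T then f else g"
      let ?I = "\<lambda>X. graph_integral U V D (\<lambda>d. ?\<alpha> (map_prod (fold_map X \<phi>) (fold_map X \<phi>) d))"
      have I: "\<bar>?I X\<bar> = val (?T X)" for X
        unfolding val_def by (intro arg_cong[where f = abs] graph_integral_cong) auto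
      have "(graph_integral U V D ?\<alpha>)\<^sup>2 \<le> ?I Q * ?I P"
        unfolding D_def
        \<comment> \<open>The folding inequality asks for a bound of at least 1, hence the
          maximum.\<close>
        by (rule graph_integral_fold[where \<alpha> = ?\<alpha> and C = "max 1 C", OF U])
          (use meas C in \<open>auto simp: le_max_iff_disj\<close>)
      also have "\<dots> \<le> val (?T Q) * val (?T P)"
        unfolding I[symmetric] abs_mult[symmetric] by (rule abs_ge_self)
      finally have "M * M \<le> val (?T Q) * val (?T P)"
        unfolding that(3)[symmetric] val_def by (simp add: power2_eq_square)
      \<comment> \<open>The opposite folding is bounded by the maximum \<open>M\<close>; cancelling
        one factor \<open>M\<close>, which is positive here, leaves
        \<open>M \<le> val (?T Q)\<close>.\<close>
      also have "\<dots> \<le> val (?T Q) * M"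
        by (intro mult_left_mono val_le) (auto simp: val_def)
      finally have "M \<le> val (?T Q)" using \<open>0 < M\<close> by simp
      with val_le[of "?T Q"] show ?thesis by auto
    qed
    have "card (J 0) = 1" "J 0 \<subseteq> E" "J N = E"
      using perc by (auto simp: strong_percolating_sequence_def percolating_sequence_via_def)
    then obtain e0 where "J 0 = {e0}" "e0 \<in> E" by (auto simp: card_1_singleton_iff)
    then obtain a0 b0 where ab: "a0 \<in> A" "b0 \<in> B" "J 0 = {{a0, b0}}"
      using G(3) unfolding bipartition_def by metis
    \<comment> \<open>The truth value \<open>s\<close> records the colour of the single edge of
      \<open>J 0\<close> in the first maximiser: true for \<open>f\<close>, false for
      \<open>g\<close>.\<close>
    define s where "s \<longleftrightarrow> (a0, b0) \<in> S0"
    \<comment> \<open>The invariant is a maximiser that is monochromatic on \<open>J i\<close>. At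
      \<open>i = N\<close> it is constant on all edges.\<close>
    have "\<exists>T\<subseteq>D. val T = M \<and> (\<forall>(a, b)\<in>D. {a, b} \<in> J i \<longrightarrow> (a, b) \<in> T \<longleftrightarrow> s)" if "i \<le> N" for i
      using that
    proof (induction i)
      case 0
      have "(a, b) = (a0, b0)" if "(a, b) \<in> D" "{a, b} \<in> J 0" for a b
        using that ab G(3) by (auto simp: D_def directed_edges_def bipartition_def doubleton_eq_iff)
      then have "(a, b) \<in> S0 \<longleftrightarrow> s" if "(a, b) \<in> D" "{a, b} \<in> J 0" for a b
        unfolding s_def using that by metis
      with S0 show ?case by blast
    next
      case (Suc i)
      then obtain T where T: "T \<subseteq> D" "val T = M" "\<forall>(a, b)\<in>D. {a, b} \<in> J i \<longrightarrow> (a, b) \<in> T \<longleftrightarrow> s"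
        by auto
      from Suc.prems have "i < N" by simp
      from strong_percolating_step[OF perc this G] obtain \<phi> P Q
        where sf: "stable_fold V E A B \<phi> P Q" and J: "J (Suc i) = pull_edges E (fold_map Q \<phi>) (J i)" .
      interpret stable_fold V E A B \<phi> P Q by fact
      let ?T = "{d \<in> D. map_prod (fold_map Q \<phi>) (fold_map Q \<phi>) d \<in> T}"
      \<comment> \<open>The folded colouring gives an edge the colour of its image, and edges of
        \<open>J (Suc i)\<close> have their images in \<open>J i\<close>.\<close>
      have "(a, b) \<in> ?T \<longleftrightarrow> s" if "(a, b) \<in> D" "{a, b} \<in> J (Suc i)" for a b
      proof -
        have "(fold_map Q \<phi> a, fold_map Q \<phi> b) \<in> D"
          using fold_edge_in_D[of "(a, b)"] that(1) by (simp add: D_def)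
        moreover have "{fold_map Q \<phi> a, fold_map Q \<phi> b} \<in> J i"
          using that(2) by (simp add: J pull_edges_def)
        ultimately show ?thesis using T(3) that(1) by auto
      qed
      with fold[OF sf T(1,2)] show ?case by (intro exI[of _ ?T]) auto
    qed
    from this[of N] obtain T where T: "T \<subseteq> D" "val T = M" "\<forall>(a, b)\<in>D. (a, b) \<in> T \<longleftrightarrow> s"
      unfolding \<open>J N = E\<close> by (auto simp: D_def directed_edges_def)
    have "val T = \<bar>graph_integral U V D (\<lambda>_. if s then f else g)\<bar>"
      unfolding val_def using T(3) by (intro arg_cong[where f = abs] graph_integral_cong) auto
    also have "\<dots> \<le> 1" using f g by simp
    finally show False using T(2) \<open>\<not> M \<le> 1\<close> by simp
  qed
  with val_le[OF \<open>S \<subseteq> D\<close>] show ?thesis by (simp add: val_def)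
qed

text \<open>After division by \<open>a\<close> and \<open>b\<close>, both constant colourings have
  integral at most 1 in absolute value, hence so has every mixed one. Multilinear expansion then
  produces a binomial sum. Positive bounds \<open>a\<close> and \<open>b\<close> permit the division
  even if an integral vanishes.\<close>

lemma graph_integral_add_le:
  fixes f g :: "'a \<times> 'a \<Rightarrow> real"
  assumes U: "prob_space U"
    and G: "simple_graph V E" "graph_connected V E" "bipartition V E A B"
    and perc: "strong_percolating_sequence V E L R J N"
    and meas: "f \<in> borel_measurable (U \<Otimes>\<^sub>M U)" "g \<in> borel_measurable (U \<Otimes>\<^sub>M U)"
    and C: "\<And>p. \<bar>f p\<bar> \<le> C" "\<And>p. \<bar>g p\<bar> \<le> C"
    and ab: "0 < a" "0 < b"
  defines "D \<equiv> directed_edges E A B"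
  assumes f: "\<bar>graph_integral U V D (\<lambda>_. f)\<bar> \<le> a ^ card D"
    and g: "\<bar>graph_integral U V D (\<lambda>_. g)\<bar> \<le> b ^ card D"
  shows "\<bar>graph_integral U V D (\<lambda>_ p. f p + g p)\<bar> \<le> (a + b) ^ card D"
proof -
  let ?f = "\<lambda>p. f p / a" and ?g = "\<lambda>p. g p / b"
  let ?\<alpha> = "\<lambda>S d. if d \<in> S then ?f else ?g"
  let ?P = "\<Pi>\<^sub>M i\<in>V. U"
  interpret P: prob_space ?P by (intro prob_space_PiM U)
  have fin: "finite D" unfolding D_def by (rule finite_directed_edges[OF G(1,3)])
  have DV: "fst d \<in> V \<and> snd d \<in> V" if "d \<in> D" for d
    using that G(3) by (auto simp: D_def directed_edges_def bipartition_def)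
  define K where "K = max (C / a) (C / b)"
  have K: "\<bar>?f p\<bar> \<le> K" "\<bar>?g p\<bar> \<le> K" for p
    using ab divide_right_mono[OF C(1)[of p], of a] divide_right_mono[OF C(2)[of p], of b]
    by (simp_all add: K_def le_max_iff_disj)
  have meas': "?f \<in> borel_measurable (U \<Otimes>\<^sub>M U)" "?g \<in> borel_measurable (U \<Otimes>\<^sub>M U)"
    using meas by simp_all
  have int: "integrable ?P (\<lambda>x. \<Prod>d\<in>D. ?\<alpha> S d (map_prod x x d))" for S
  proof (rule P.integrable_const_bound[where B = "K ^ card D"], rule AE_I2)
    have \<alpha>: "?\<alpha> S d \<in> borel_measurable (U \<Otimes>\<^sub>M U)" "\<bar>?\<alpha> S d p\<bar> \<le> K" for d p
      using meas' K by auto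
    show "(\<lambda>x. \<Prod>d\<in>D. ?\<alpha> S d (map_prod x x d)) \<in> borel_measurable ?P"
      by (rule edge_prod(1)[where \<alpha> = "?\<alpha> S", OF DV \<alpha>])
    show "norm (\<Prod>d\<in>D. ?\<alpha> S d (map_prod x x d)) \<le> K ^ card D" for x
      unfolding real_norm_def by (rule edge_prod(3)[where \<alpha> = "?\<alpha> S", OF DV \<alpha>])
  qed
  \<comment> \<open>The set \<open>S\<close> consists of the edges that take the summand
    \<open>f\<close>; the scaling factors become its weight.\<close>
  have expand: "(\<Prod>d\<in>D. f (map_prod x x d) + g (map_prod x x d)) =
    (\<Sum>S\<in>Pow D. a ^ card S * b ^ card (D - S) * (\<Prod>d\<in>D. ?\<alpha> S d (map_prod x x d)))" for x
  proof -
    have "(\<Prod>d\<in>D. f (map_prod x x d) + g (map_prod x x d)) =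
      (\<Prod>d\<in>D. a * ?f (map_prod x x d) + b * ?g (map_prod x x d))"
      using ab by simp
    also have "\<dots> = (\<Sum>S\<in>Pow D. (\<Prod>d\<in>S. a * ?f (map_prod x x d)) * (\<Prod>d\<in>D - S. b * ?g (map_prod x x d)))"
      by (rule prod_add[OF fin])
    also have "\<dots> = (\<Sum>S\<in>Pow D. a ^ card S * b ^ card (D - S) * (\<Prod>d\<in>D. ?\<alpha> S d (map_prod x x d)))"
    proof (intro sum.cong refl)
      fix S assume "S \<in> Pow D"
      then have "D \<inter> {d. d \<in> S} = S" "D \<inter> - {d. d \<in> S} = D - S" by auto
      then have "(\<Prod>d\<in>D. if d \<in> S then ?f (map_prod x x d) else ?g (map_prod x x d)) =
        (\<Prod>d\<in>S. ?f (map_prod x x d)) * (\<Prod>d\<in>D - S. ?g (map_prod x x d))"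
        by (subst prod.If_cases[OF fin]) simp
      then show "(\<Prod>d\<in>S. a * ?f (map_prod x x d)) * (\<Prod>d\<in>D - S. b * ?g (map_prod x x d)) =
        a ^ card S * b ^ card (D - S) * (\<Prod>d\<in>D. ?\<alpha> S d (map_prod x x d))"
        by (simp only: prod.distrib prod_constant if_distrib[where f = "\<lambda>h. h (map_prod x x _)"] mult_ac)
    qed
    finally show ?thesis .
  qed
  have scale: "\<bar>graph_integral U V D (\<lambda>_ p. h p / c)\<bar> \<le> 1"
    if "\<bar>graph_integral U V D (\<lambda>_. h)\<bar> \<le> c ^ card D" "0 < c" for h :: "'a \<times> 'a \<Rightarrow> real" and c
    using that by (simp add: graph_integral_def prod_dividef abs_div)
  have "graph_integral U V D (\<lambda>_ p. f p + g p) =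
    (\<Sum>S\<in>Pow D. a ^ card S * b ^ card (D - S) * graph_integral U V D (?\<alpha> S))"
    unfolding graph_integral_def expand using int by (simp add: Bochner_Integration.integral_sum)
  also have "\<bar>\<dots>\<bar> \<le> (\<Sum>S\<in>Pow D. \<bar>a ^ card S * b ^ card (D - S) * graph_integral U V D (?\<alpha> S)\<bar>)"
    by (rule sum_abs)
  also have "\<dots> \<le> (\<Sum>S\<in>Pow D. a ^ card S * b ^ card (D - S))"
  proof (rule sum_mono)
    fix S assume "S \<in> Pow D"
    then have "\<bar>graph_integral U V D (?\<alpha> S)\<bar> \<le> 1"
      unfolding D_def
      using graph_integral_two_colours[OF U G perc meas' K] scale[OF f ab(1)] scale[OF g ab(2)]
      by (simp add: D_def)
    then show "\<bar>a ^ card S * b ^ card (D - S) * graph_integral U V D (?\<alpha> S)\<bar> \<le> a ^ card S * b ^ card (D - S)"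
      using ab by (simp add: abs_mult mult_left_le)
  qed
  also have "\<dots> = (\<Prod>d\<in>D. a + b)"
    \<comment> \<open>The same expansion over subsets, applied to the constants \<open>a\<close> and
      \<open>b\<close> and read backwards.\<close>
    by (subst prod_add[OF fin]) simp
  finally show ?thesis by simp
qed

text \<open>A map sending every edge onto one fixed edge is a proper colouring with two
  colours.\<close>

lemma percolating_imp_bipartite:
  assumes "simple_graph V E" and perc: "percolating_sequence_via V E L R \<Phi> J N"
  shows "\<exists>A B. bipartition V E A B"
proof -
  have "\<exists>g. \<forall>e\<in>J i. g ` e \<in> J 0" if "i \<le> N" for i
    using that
  proof (induction i)
    case 0
    show ?case by (intro exI[of _ id]) simp
  next
    case (Suc i)
    then obtain g where g: "\<forall>e\<in>J i. g ` e \<in> J 0" by auto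
    obtain h where "J (Suc i) = pull_edges E h (J i)"
      using perc Suc.prems unfolding percolating_sequence_via_def by (metis Suc_le_eq)
    \<comment> \<open>The newest folding acts first: it sends \<open>J (Suc i)\<close> into
      \<open>J i\<close>, from where \<open>g\<close> continues.\<close>
    with g have "\<forall>e\<in>J (Suc i). (g \<circ> h) ` e \<in> J 0"
      unfolding image_comp[symmetric] by (simp add: pull_edges_def)
    then show ?case by blast
  qed
  from this[of N] obtain g where g: "\<forall>e\<in>E. g ` e \<in> J 0"
    using perc by (auto simp: percolating_sequence_via_def)
  obtain e0 where e0: "J 0 = {e0}" "e0 \<in> E"
    using perc by (auto simp: percolating_sequence_via_def card_1_singleton_iff)
  then obtain p q where pq: "e0 = {p, q}" "p \<noteq> q"
    using assms(1) by (auto simp: simple_graph_def card_2_iff)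
  \<comment> \<open>The second class uses \<open>g v \<noteq> p\<close> instead of
    \<open>g v = q\<close>, so that it also takes in isolated vertices, whose image is
    unknown.\<close>
  have "bipartition V E {v \<in> V. g v = p} {v \<in> V. g v \<noteq> p}"
    unfolding bipartition_def
  proof (intro conjI ballI)
    fix e assume e: "e \<in> E"
    then have "e \<subseteq> V" "card e = 2" using assms(1) by (auto simp: simple_graph_def)
    then obtain u v where uv: "e = {u, v}" "u \<in> V" "v \<in> V"
      unfolding card_2_iff by blast
    have "g ` e = {p, q}" using bspec[OF g e] unfolding e0(1) pq(1) by simp
    then have "{g u, g v} = {p, q}" unfolding uv(1) by simp
    with pq(2) have "g u = p \<and> g v \<noteq> p \<or> g v = p \<and> g u \<noteq> p" by (auto simp: doubleton_eq_iff)
    then show "\<exists>a\<in>{v \<in> V. g v = p}. \<exists>b\<in>{v \<in> V. g v \<noteq> p}. e = {a, b}"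
      using uv insert_commute[of u v "{}"] by blast
  qed auto
  then show ?thesis by blast
qed

section \<open>Lebesgue measurable kernels\<close>

text \<open>Two distinct coordinates are independent with law \<open>U\<close>; comparing measures
  of rectangles suffices. Null sets of kernels can thereby be pulled back to the cube.\<close>

lemma distr_PiM_pair:
  assumes "prob_space U" "finite V" "a \<in> V" "b \<in> V" "a \<noteq> b"
  shows "distr (\<Pi>\<^sub>M i\<in>V. U) (U \<Otimes>\<^sub>M U) (\<lambda>x. (x a, x b)) = U \<Otimes>\<^sub>M U"
proof (rule pair_measure_eqI[symmetric])
  interpret U: prob_space U by fact
  interpret product_sigma_finite "\<lambda>_. U" ..
  show "sigma_finite_measure U" "sigma_finite_measure U" by unfold_locales
  fix X Y assume XY: "X \<in> sets U" "Y \<in> sets U"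
  let ?S = "\<lambda>i. if i = a then X else if i = b then Y else space U"
  have m: "(\<lambda>x. (x a, x b)) \<in> measurable (\<Pi>\<^sub>M i\<in>V. U) (U \<Otimes>\<^sub>M U)"
    using assms(3,4) by (intro measurable_Pair measurable_component_singleton)
  have "(\<lambda>x. (x a, x b)) -` (X \<times> Y) \<inter> space (\<Pi>\<^sub>M i\<in>V. U) = (\<Pi>\<^sub>E i\<in>V. ?S i)"
  proof (intro equalityI subsetI)
    fix x assume x: "x \<in> (\<Pi>\<^sub>E i\<in>V. ?S i)"
    have "?S i \<subseteq> space U" for i using XY[THEN sets.sets_into_space] by simp
    with x have "x \<in> (\<Pi>\<^sub>E i\<in>V. space U)" by (meson PiE_mono subsetD)
    moreover have "x a \<in> X" "x b \<in> Y"
      using PiE_mem[OF x assms(3)] PiE_mem[OF x assms(4)] assms(5) by auto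
    ultimately show "x \<in> (\<lambda>x. (x a, x b)) -` (X \<times> Y) \<inter> space (\<Pi>\<^sub>M i\<in>V. U)"
      by (simp add: space_PiM)
  qed (auto simp: space_PiM PiE_iff)
  then have "emeasure (distr (\<Pi>\<^sub>M i\<in>V. U) (U \<Otimes>\<^sub>M U) (\<lambda>x. (x a, x b))) (X \<times> Y) = (\<Prod>i\<in>V. emeasure U (?S i))"
    using XY m assms(2) by (simp add: emeasure_distr emeasure_PiM)
  also have "\<dots> = (\<Prod>i\<in>{a, b}. emeasure U (?S i))"
    using assms(2-4) by (intro prod.mono_neutral_right) (auto simp: U.emeasure_space_1)
  finally show "emeasure U X * emeasure U Y = emeasure (distr (\<Pi>\<^sub>M i\<in>V. U) (U \<Otimes>\<^sub>M U) (\<lambda>x. (x a, x b))) (X \<times> Y)"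
    using assms(5) by simp
qed simp

lemma AE_PiM_pair:
  assumes "prob_space U" "finite V" "a \<in> V" "b \<in> V" "a \<noteq> b" and AE: "AE p in U \<Otimes>\<^sub>M U. Q p"
  shows "AE x in \<Pi>\<^sub>M i\<in>V. U. Q (x a, x b)"
proof (rule AE_distrD[where M' = "U \<Otimes>\<^sub>M U"])
  show "(\<lambda>x. (x a, x b)) \<in> measurable (\<Pi>\<^sub>M i\<in>V. U) (U \<Otimes>\<^sub>M U)"
    using assms(3,4) by (intro measurable_Pair measurable_component_singleton)
  show "AE p in distr (\<Pi>\<^sub>M i\<in>V. U) (U \<Otimes>\<^sub>M U) (\<lambda>x. (x a, x b)). Q p"
    unfolding distr_PiM_pair[OF assms(1-5)] by (rule AE)
qed

text \<open>Measurability of \<open>f\<close> is a conclusion: each preimage under \<open>f\<close>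
  differs from the one under \<open>g\<close> within a null set, and the completion contains all
  subsets of null sets.\<close>

lemma integral_completion_cong_AE:
  fixes f g :: "'a \<Rightarrow> real"
  assumes g: "g \<in> borel_measurable M" and AE: "AE x in M. f x = g x"
  shows "integral\<^sup>L (completion M) f = integral\<^sup>L M g"
proof -
  have [measurable]: "g \<in> borel_measurable (completion M)"
    by (rule measurable_completion[OF g])
  have neq: "Measurable.pred (completion M) (\<lambda>x. f x \<noteq> g x)"
    using AE by (intro sets_completion_AE) auto
  have "f \<in> borel_measurable (completion M)"
  proof (rule measurableI)
    fix B :: "real set" assume B: "B \<in> sets borel"
    have "Measurable.pred (completion M) (\<lambda>x. f x \<noteq> g x \<and> f x \<in> B)"
      using AE by (intro sets_completion_AE) auto
    moreover have "Measurable.pred (completion M) (\<lambda>x. g x \<in> B)" using B by measurable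
    ultimately have "Measurable.pred (completion M) (\<lambda>x. f x \<noteq> g x \<and> f x \<in> B \<or> \<not> f x \<noteq> g x \<and> g x \<in> B)"
      using neq by measurable
    then have "{x \<in> space (completion M). f x \<noteq> g x \<and> f x \<in> B \<or> \<not> f x \<noteq> g x \<and> g x \<in> B} \<in> sets (completion M)"
      by (rule predE)
    also have "{x \<in> space (completion M). f x \<noteq> g x \<and> f x \<in> B \<or> \<not> f x \<noteq> g x \<and> g x \<in> B} =
      f -` B \<inter> space (completion M)" by auto
    finally show "f -` B \<inter> space (completion M) \<in> sets (completion M)" .
  qed simp
  then have "integral\<^sup>L (completion M) f = integral\<^sup>L (completion M) g"
    using AE_completion[OF AE] by (intro integral_cong_AE) auto
  then show ?thesis by (simp add: integral_completion[OF g])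
qed

section \<open>Almost everywhere statements on the unit square\<close>

definition unit_measure :: "real measure" where
  "unit_measure = restrict_space lborel {0..1}"

lemma prob_space_unit_measure: "prob_space unit_measure"
  by (rule prob_spaceI) (simp add: unit_measure_def space_restrict_space emeasure_restrict_space)

lemma AE_unit_measure:
  assumes "AE x in lborel. Q x"
  shows "AE x in unit_measure. Q x"
  using assms unfolding unit_measure_def by (subst AE_restrict_space_iff) (auto elim!: eventually_mono)

lemma measurable_unit_square:
  assumes "f \<in> borel_measurable borel"
  shows "f \<in> borel_measurable (unit_measure \<Otimes>\<^sub>M unit_measure)"
proof -
  have [measurable]: "(\<lambda>x. x) \<in> borel_measurable unit_measure"
    unfolding unit_measure_def by (rule measurable_restrict_space1) simp
  have "(\<lambda>p. (fst p, snd p)) \<in> borel_measurable (unit_measure \<Otimes>\<^sub>M unit_measure)"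
    by measurable
  from measurable_compose[OF this assms] show ?thesis by simp
qed

text \<open>Fubini turns a planar null set into an iterated statement, which restricts to the
  interval in each variable separately. The way back needs measurability, so the exceptional set is
  first enlarged to the measurable null set \<open>N\<close>.\<close>

lemma AE_unit_square:
  assumes "AE p in lborel. Q p"
  shows "AE p in unit_measure \<Otimes>\<^sub>M unit_measure. Q p"
proof -
  interpret U: prob_space unit_measure by (rule prob_space_unit_measure)
  interpret UU: pair_sigma_finite unit_measure unit_measure ..
  obtain N where N: "N \<in> null_sets lborel" and NQ: "{p \<in> space lborel. \<not> Q p} \<subseteq> N"
    using assms unfolding eventually_ae_filter by blast
  have "AE p in lborel \<Otimes>\<^sub>M lborel. p \<notin> N"
    unfolding lborel_prod by (rule AE_not_in[OF N])
  then have "AE x in lborel. AE y in lborel. (x, y) \<notin> N"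
    by (rule lborel_pair.AE_pair)
  then have "AE x in unit_measure. AE y in unit_measure. (x, y) \<notin> N"
    by (auto intro!: AE_unit_measure elim!: eventually_mono)
  moreover have "{p \<in> space (unit_measure \<Otimes>\<^sub>M unit_measure). p \<notin> N} \<in> sets (unit_measure \<Otimes>\<^sub>M unit_measure)"
  proof -
    have "indicat_real N \<in> borel_measurable (unit_measure \<Otimes>\<^sub>M unit_measure)"
      using N by (intro measurable_unit_square borel_measurable_indicator) auto
    then have "(\<lambda>p. indicat_real N p) -` {0} \<inter> space (unit_measure \<Otimes>\<^sub>M unit_measure) \<in> sets (unit_measure \<Otimes>\<^sub>M unit_measure)"
      by (rule measurable_sets) simp
    also have "(\<lambda>p. indicat_real N p) -` {0} \<inter> space (unit_measure \<Otimes>\<^sub>M unit_measure) =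
      {p \<in> space (unit_measure \<Otimes>\<^sub>M unit_measure). p \<notin> N}"
      by (auto simp: indicator_def)
    finally show ?thesis .
  qed
  ultimately have "AE p in unit_measure \<Otimes>\<^sub>M unit_measure. p \<notin> N"
    by (intro UU.AE_pair_measure) auto
  then show ?thesis by eventually_elim (use NQ in auto)
qed

text \<open>The bound on \<open>g\<close> holds at all points, also outside the square, because the
  folding lemmas bound kernels everywhere.\<close>

definition borel_version :: "(real \<times> real \<Rightarrow> real) \<Rightarrow> (real \<times> real \<Rightarrow> real) \<Rightarrow> bool" where
  "borel_version f g \<longleftrightarrow> g \<in> borel_measurable (unit_measure \<Otimes>\<^sub>M unit_measure)
     \<and> (\<exists>C. \<forall>p. \<bar>g p\<bar> \<le> C) \<and> (AE p in unit_measure \<Otimes>\<^sub>M unit_measure. f p = g p)"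

lemma kernel_borel_version:
  assumes "f \<in> kernels"
  shows "\<exists>g. borel_version f g"
proof -
  let ?S = "{0..1::real} \<times> {0..1::real}"
  have "f \<in> borel_measurable (lebesgue_on ?S)" using assms by (simp add: kernels_def)
  then have "(\<lambda>p. if p \<in> ?S then f p else 0) \<in> borel_measurable (completion lborel)"
    by (subst borel_measurable_if) (auto intro!: sets_completionI_sets borel_closed closed_Times)
  then obtain h where h: "h \<in> borel_measurable lborel"
    "AE p in lborel. (if p \<in> ?S then f p else 0) = h p"
    using completion_ex_borel_measurable_real by blast
  obtain C where C: "\<And>p. p \<in> ?S \<Longrightarrow> \<bar>f p\<bar> \<le> C"
    using assms by (auto simp: kernels_def bounded_iff)
  \<comment> \<open>Truncation bounds \<open>h\<close> everywhere and changes nothing where it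
    agrees with \<open>f\<close> on the square.\<close>
  let ?g = "\<lambda>p. max (- \<bar>C\<bar>) (min \<bar>C\<bar> (h p))"
  have "?g \<in> borel_measurable (unit_measure \<Otimes>\<^sub>M unit_measure)"
    using h(1) by (intro measurable_unit_square) auto
  moreover have "\<forall>p. \<bar>?g p\<bar> \<le> \<bar>C\<bar>" by auto
  moreover have "AE p in unit_measure \<Otimes>\<^sub>M unit_measure. f p = ?g p"
    using AE_unit_square[OF h(2)] AE_space
  proof eventually_elim
    case (elim p)
    then have "p \<in> ?S"
      by (auto simp: space_pair_measure unit_measure_def space_restrict_space)
    with elim(1) C[of p] show ?case by auto
  qed
  ultimately show ?thesis unfolding borel_version_def by blast
qed

lemma borel_version_cmult:
  assumes "borel_version f g"
  shows "borel_version (\<lambda>p. c * f p) (\<lambda>p. c * g p)"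
proof -
  obtain C where "\<forall>p. \<bar>g p\<bar> \<le> C" using assms by (auto simp: borel_version_def)
  then have "\<forall>p. \<bar>c * g p\<bar> \<le> \<bar>c\<bar> * C" by (auto simp: abs_mult intro: mult_left_mono)
  then show ?thesis using assms unfolding borel_version_def by auto
qed

lemma borel_version_add:
  assumes "borel_version f g" "borel_version f' g'"
  shows "borel_version (\<lambda>p. f p + f' p) (\<lambda>p. g p + g' p)"
proof -
  obtain C C' where "\<forall>p. \<bar>g p\<bar> \<le> C" "\<forall>p. \<bar>g' p\<bar> \<le> C'" using assms by (auto simp: borel_version_def)
  then have "\<forall>p. \<bar>g p + g' p\<bar> \<le> C + C'" by (meson abs_triangle_ineq add_mono order_trans)
  then show ?thesis using assms unfolding borel_version_def by auto
qed

text \<open>Replacing \<open>f\<close> by \<open>g\<close> alters the integrand only on a finite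
  union of null sets, one for each edge, so the completed integral becomes an ordinary one.\<close>

lemma graph_norm_borel_version:
  assumes G: "simple_graph V E" "bipartition V E A B" and f: "borel_version f g"
  shows "graph_norm V E A B f =
    \<bar>graph_integral unit_measure V (directed_edges E A B) (\<lambda>_. g)\<bar> powr (1 / real (card E))"
proof -
  let ?D = "directed_edges E A B" and ?P = "\<Pi>\<^sub>M i\<in>V. unit_measure"
  have fin: "finite ?D" by (rule finite_directed_edges[OF G])
  have finV: "finite V" using G(1) by (simp add: simple_graph_def)
  have DV: "fst d \<in> V \<and> snd d \<in> V" if "d \<in> ?D" for d
    using that G(2) by (auto simp: directed_edges_def bipartition_def)
  \<comment> \<open>Equal ends would put the pair of coordinates on the diagonal, itself a null set
    where \<open>f\<close> and \<open>g\<close> might differ.\<close>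
  have neq: "fst d \<noteq> snd d" if "d \<in> ?D" for d
    using that G(2) by (auto simp: directed_edges_def bipartition_def)
  have "AE x in ?P. f (x (fst d), x (snd d)) = g (x (fst d), x (snd d))" if "d \<in> ?D" for d
    using AE_PiM_pair[OF prob_space_unit_measure finV conjunct1[OF DV[OF that]] conjunct2[OF DV[OF that]]
        neq[OF that], of "\<lambda>p. f p = g p"] f by (simp add: borel_version_def)
  then have "AE x in ?P. \<forall>d\<in>?D. f (x (fst d), x (snd d)) = g (x (fst d), x (snd d))"
    using fin by (simp add: AE_finite_all)
  then have AE: "AE x in ?P. (\<Prod>(a, b)\<in>?D. f (x a, x b)) = (\<Prod>d\<in>?D. g (map_prod x x d))"
    by eventually_elim (auto intro!: prod.cong simp: split_beta' map_prod_def)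
  obtain C where "\<And>p. \<bar>g p\<bar> \<le> C" and "g \<in> borel_measurable (unit_measure \<Otimes>\<^sub>M unit_measure)"
    using f by (auto simp: borel_version_def)
  then have "(\<lambda>x. \<Prod>d\<in>?D. g (map_prod x x d)) \<in> borel_measurable ?P"
    using edge_prod(1)[where \<alpha> = "\<lambda>_. g", OF DV] by blast
  from integral_completion_cong_AE[OF this AE] show ?thesis
    unfolding graph_norm_def graph_integral_def cube_measure_def
    by (simp only: directed_edges_def unit_measure_def)
qed

lemma seminorm_graph_norm:
  assumes G: "simple_graph V E" "graph_connected V E" and bip: "bipartition V E A B"
    and perc: "strong_percolating_sequence V E L R J N"
  shows "seminorm_on kernels (graph_norm V E A B)"
proof -
  let ?D = "directed_edges E A B"
  let ?I = "\<lambda>g. \<bar>graph_integral unit_measure V ?D (\<lambda>_. g)\<bar>"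
  let ?m = "card ?D"
  have fin: "finite ?D" and m: "?m = card E"
    using finite_directed_edges[OF G(1) bip] card_directed_edges[OF G(1) bip] .
  have "card (J 0) = 1" "J 0 \<subseteq> E"
    using perc by (auto simp: strong_percolating_sequence_def percolating_sequence_via_def)
  \<comment> \<open>The edge in \<open>J 0\<close> makes \<open>?m\<close> positive, so that taking
    the root inverts the power.\<close>
  then have "E \<noteq> {}" by auto
  moreover have "finite E"
    using G(1) unfolding simple_graph_def by (auto intro: finite_subset[of E "Pow V"])
  ultimately have "0 < ?m" unfolding m by (simp add: card_gt_0_iff)
  have norm: "graph_norm V E A B f = ?I g powr (1 / real ?m)" if "borel_version f g" for f g
    using graph_norm_borel_version[OF G(1) bip that] m by simp
  have root: "(x ^ ?m) powr (1 / real ?m) = x" if "0 \<le> x" for x :: real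
    using that \<open>0 < ?m\<close> by (cases "x = 0") (simp_all add: powr_realpow[symmetric] powr_powr)
  have root': "(x powr (1 / real ?m)) ^ ?m = x" if "0 \<le> x" for x :: real
    using that \<open>0 < ?m\<close> by (cases "x = 0") (simp_all add: powr_realpow[symmetric] powr_powr)
  show ?thesis unfolding seminorm_on_def
  proof (intro conjI ballI allI)
    show "0 \<le> graph_norm V E A B f" for f by (simp add: graph_norm_def)
    fix f assume "f \<in> kernels"
    then obtain f' where f': "borel_version f f'" using kernel_borel_version by blast
    show "graph_norm V E A B (\<lambda>p. c * f p) = \<bar>c\<bar> * graph_norm V E A B f" for c
    proof -
      have "?I (\<lambda>p. c * f' p) = \<bar>c\<bar> ^ ?m * ?I f'"
        by (simp add: graph_integral_def prod.distrib abs_mult power_abs)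
      then show ?thesis
        unfolding norm[OF f'] norm[OF borel_version_cmult[OF f']]
        by (simp add: powr_mult root)
    qed
    fix g assume "g \<in> kernels"
    then obtain g' where g': "borel_version g g'" using kernel_borel_version by blast
    show "graph_norm V E A B (\<lambda>p. f p + g p) \<le> graph_norm V E A B f + graph_norm V E A B g"
    \<comment> \<open>Either norm may be zero, whereas \<open>graph_integral_add_le\<close> needs
      positive bounds; adding \<open>e / 2\<close> to each provides them.\<close>
    proof (rule field_le_epsilon)
      fix e :: real assume "0 < e"
      let ?a = "graph_norm V E A B f + e / 2" and ?b = "graph_norm V E A B g + e / 2"
      obtain C1 C2 where C12: "\<And>p. \<bar>f' p\<bar> \<le> C1" "\<And>p. \<bar>g' p\<bar> \<le> C2"
        using f' g' by (auto simp: borel_version_def)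
      have C: "\<bar>f' p\<bar> \<le> max C1 C2" "\<bar>g' p\<bar> \<le> max C1 C2" for p
        using C12[of p] by auto
      have pos: "0 < ?a" "0 < ?b"
        using \<open>0 < e\<close> by (simp_all add: graph_norm_def add_nonneg_pos)
      have bound: "?I h \<le> (graph_norm V E A B k + e / 2) ^ ?m" if "borel_version k h" for k h
      proof -
        have "?I h = (graph_norm V E A B k) ^ ?m" unfolding norm[OF that] by (simp add: root')
        also have "\<dots> \<le> (graph_norm V E A B k + e / 2) ^ ?m"
          using \<open>0 < e\<close> by (intro power_mono) (auto simp: graph_norm_def)
        finally show ?thesis .
      qed
      have "?I (\<lambda>p. f' p + g' p) \<le> (?a + ?b) ^ ?m"
        using f' g'
        by (intro graph_integral_add_le[OF prob_space_unit_measure G bip perc _ _ C pos] bound)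
          (auto simp: borel_version_def)
      then have "?I (\<lambda>p. f' p + g' p) powr (1 / real ?m) \<le> ((?a + ?b) ^ ?m) powr (1 / real ?m)"
        by (intro powr_mono2) auto
      also have "\<dots> = ?a + ?b" using pos by (intro root) simp
      finally show "graph_norm V E A B (\<lambda>p. f p + g p) \<le>
        graph_norm V E A B f + graph_norm V E A B g + e"
        unfolding norm[OF borel_version_add[OF f' g']] by simp
    qed
  qed
qed

theorem theorem3p4:
  fixes V :: "'v set" and E :: "'v set set"
    and L R :: "('v \<Rightarrow> 'v) \<Rightarrow> 'v set"
  assumes "simple_graph V E" and "graph_connected V E"
    and "edge_transitive_under (stable_involution_group V E) E"
    and "sides_choice V E L R"
    and "\<exists>J N. strong_percolating_sequence V E L R J N"
  shows "norming V E"
proof -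
  obtain J N where perc: "strong_percolating_sequence V E L R J N" using assms(5) by blast
  have "\<exists>A B. bipartition V E A B"
    using percolating_imp_bipartite[OF assms(1)] perc unfolding strong_percolating_sequence_def by blast
  then show ?thesis
    using seminorm_graph_norm[OF assms(1,2) _ perc] by (simp add: norming_def)
qed

end
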